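(* Let $(X,d)$ be a cone metric space over a real Banach space $E$ with cone $P$, let $I$ be an admissible ideal in $\mathbb{N}$, and let $r\in E$ with $0\ll r$ or $r=0$. If a sequence $\{x_n\}$ in $X$ is rough $I^*$-convergent of roughness degree $r$ to $x\in X$, then $\{x_n\}$ is also rough $I$-convergent of the same roughness degree $r$ to $x$.
   Context: Let $E$ be a real Banach space with zero element $0$. A subset $P\subset E$ is a cone if (i) $P$ is closed, nonempty and $P\neq\{0\}$; (ii) $ax+by\in P$ for all $x,y\in P$ and real $a,b\ge 0$; (iii) $x\in P$ and $-x\in P$ imply $x=0$. For $x,y\in E$: $x\le y$ means $y-x\in P$; $x<y$ means $x\le y$ and $x\ne y$; $x\ll y$ means $y-x\in\operatorname{int}P$. A cone metric space $(X,d)$ is a nonempty set $X$ with a map $d:X\times X\to E$ such that $0\le d(x,y)$, $d(x,y)=0$ iff $x=y$, $d(x,y)=d(y,x)$, and $d(x,y)\le d(x,z)+d(z,y)$ for all $x,y,z\in X$. An ideal $I$ in $\mathbb{N}$ is a family of subsets of $\mathbb{N}$ closed under finite unions and under taking subsets; it is admissible if $I\ne\{\emptyset\}$, $\mathbb{N}\notin I$, and $\{n\}\in I$ for each $n\in\mathbb{N}$. Its associated filter is $F(I)=\{\mathbb{N}\setminus A: A\in I\}$. A sequence $\{x_n\}$ in $X$ is rough $I$-convergent of roughness degree $r$ to $x\in X$ (where $0\ll r$ or $r=0$) if for every $\varepsilon\in E$ with $0\ll\varepsilon$ the set $\{n\in\mathbb{N}: r+\varepsilon-d(x_n,x)\notin\operatorname{int}P\}$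 belongs to $I$. It is rough $I^*$-convergent of roughness degree $r$ to $x$ if there is a set $M=\{m_1<m_2<\cdots<m_k<\cdots\}\in F(I)$ such that for every $\varepsilon\in E$ with $0\ll\varepsilon$ there is $k\in\mathbb{N}$ with $d(x_{m_p},x)\ll r+\varepsilon$ for all $p\ge k$. *)

theory Defs
  imports "HOL-Analysis.Analysis"
begin

text \<open>
  The library constant \<^const>\<open>cone\<close> only asks for closure under nonnegative scaling;
  the cones of cone metric spaces are also closed, convex, pointed and different from the zero
  cone.  The interior is not required to be nonempty.
\<close>

definition order_cone :: "'e::real_normed_vector set \<Rightarrow> bool" where
  "order_cone P \<longleftrightarrow>
     closed P \<and> P \<noteq> {} \<and> P \<noteq> {0} \<and>
     (\<forall>x\<in>P. \<forall>y\<in>P. \<forall>a b::real. a \<ge> 0 \<longrightarrow> b \<ge> 0 \<longrightarrow> a *\<^sub>R x + b *\<^sub>R y \<in> P) \<and>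
     (\<forall>x. x \<in> P \<longrightarrow> - x \<in> P \<longrightarrow> x = 0)"

definition cone_le :: "'e::real_normed_vector set \<Rightarrow> 'e \<Rightarrow> 'e \<Rightarrow> bool" where
  "cone_le P x y \<longleftrightarrow> y - x \<in> P"

definition cone_ll :: "'e::real_normed_vector set \<Rightarrow> 'e \<Rightarrow> 'e \<Rightarrow> bool" where
  "cone_ll P x y \<longleftrightarrow> y - x \<in> interior P"

definition cone_metric_space ::
    "'e::real_normed_vector set \<Rightarrow> 'x set \<Rightarrow> ('x \<Rightarrow> 'x \<Rightarrow> 'e) \<Rightarrow> bool" where
  "cone_metric_space P X d \<longleftrightarrow>
     X \<noteq> {} \<and>
     (\<forall>x\<in>X. \<forall>y\<in>X. cone_le P 0 (d x y)) \<and>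
     (\<forall>x\<in>X. \<forall>y\<in>X. d x y = 0 \<longleftrightarrow> x = y) \<and>
     (\<forall>x\<in>X. \<forall>y\<in>X. d x y = d y x) \<and>
     (\<forall>x\<in>X. \<forall>y\<in>X. \<forall>z\<in>X. cone_le P (d x y) (d x z + d z y))"

definition nat_ideal :: "nat set set \<Rightarrow> bool" where
  "nat_ideal I \<longleftrightarrow>
     (\<forall>\<A>. finite \<A> \<longrightarrow> \<A> \<subseteq> I \<longrightarrow> \<Union>\<A> \<in> I) \<and>
     (\<forall>A B. A \<in> I \<longrightarrow> B \<subseteq> A \<longrightarrow> B \<in> I)"

definition admissible_ideal :: "nat set set \<Rightarrow> bool" where
  "admissible_ideal I \<longleftrightarrow>
     nat_ideal I \<and> I \<noteq> {{}} \<and> UNIV \<notin> I \<and> (\<forall>n. {n} \<in> I)"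

definition ideal_filter :: "nat set set \<Rightarrow> nat set set" where
  "ideal_filter I = {UNIV - A | A. A \<in> I}"

definition rough_I_convergent ::
    "'e::real_normed_vector set \<Rightarrow> ('x \<Rightarrow> 'x \<Rightarrow> 'e) \<Rightarrow> nat set set \<Rightarrow> 'e \<Rightarrow> (nat \<Rightarrow> 'x) \<Rightarrow> 'x \<Rightarrow> bool" where
  "rough_I_convergent P d I r x l \<longleftrightarrow>
     (\<forall>\<epsilon>. cone_ll P 0 \<epsilon> \<longrightarrow> {n. r + \<epsilon> - d (x n) l \<notin> interior P} \<in> I)"

text \<open>
  The map \<open>m\<close> is the increasing enumeration of the set \<open>M\<close>, starting with index 0.
\<close>

definition rough_I_star_convergent ::
    "'e::real_normed_vector set \<Rightarrow> ('x \<Rightarrow> 'x \<Rightarrow> 'e) \<Rightarrow> nat set set \<Rightarrow> 'e \<Rightarrow> (nat \<Rightarrow> 'x) \<Rightarrow> 'x \<Rightarrow> bool" where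
  "rough_I_star_convergent P d I r x l \<longleftrightarrow>
     (\<exists>M\<in>ideal_filter I. \<exists>m::nat \<Rightarrow> nat. strict_mono m \<and> range m = M \<and>
        (\<forall>\<epsilon>. cone_ll P 0 \<epsilon> \<longrightarrow> (\<exists>k. \<forall>p\<ge>k. cone_ll P (d (x (m p)) l) (r + \<epsilon>))))"

end

theory Submission
  imports Defs
begin

text \<open>
  Along an index set \<open>M\<close> from the filter, each \<open>\<epsilon>\<close> is violated only by the finitely many
  members of \<open>M\<close> that are enumerated before the threshold for \<open>\<epsilon>\<close>; every other violating
  index lies in the complement of \<open>M\<close>, which belongs to the ideal.  An admissible ideal contains
  all finite sets, so the violating indices are covered by the union of two members of the ideal.
\<close>

lemma nat_ideal_Union:
  assumes "nat_ideal I" and "finite \<A>" and "\<A> \<subseteq> I"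
  shows "\<Union>\<A> \<in> I"
  using assms(1)[unfolded nat_ideal_def, THEN conjunct1, rule_format, OF assms(2,3)] .

lemma nat_ideal_Un:
  assumes "nat_ideal I" and "A \<in> I" and "B \<in> I"
  shows "A \<union> B \<in> I"
proof -
  have "\<Union>{A, B} \<in> I"
    by (rule nat_ideal_Union[OF assms(1)]) (simp_all add: assms(2,3))
  then show ?thesis by simp
qed

lemma nat_ideal_subset:
  assumes "nat_ideal I" and "A \<in> I" and "B \<subseteq> A"
  shows "B \<in> I"
  using assms(1)[unfolded nat_ideal_def, THEN conjunct2, rule_format, OF assms(2,3)] .

lemma finite_in_admissible_ideal:
  assumes "admissible_ideal I" and "finite F"
  shows "F \<in> I"
proof -
  have I: "nat_ideal I" and sing: "{n} \<in> I" for n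
    using assms(1) unfolding admissible_ideal_def by blast+
  have "(\<lambda>n. {n}) ` F \<subseteq> I"
    by (rule image_subsetI) (rule sing)
  then have "\<Union>((\<lambda>n. {n}) ` F) \<in> I"
    by (rule nat_ideal_Union[OF I finite_imageI[OF assms(2)]])
  then show ?thesis by simp
qed

theorem theorem3p11:
  fixes P :: "'e::banach set"
    and X :: "'x set"
    and d :: "'x \<Rightarrow> 'x \<Rightarrow> 'e"
    and I :: "nat set set"
    and r :: 'e
    and x :: "nat \<Rightarrow> 'x"
    and l :: 'x
  assumes "order_cone P"
    and "cone_metric_space P X d"
    and "admissible_ideal I"
    and "cone_ll P 0 r \<or> r = 0"
    and "\<And>n. x n \<in> X"
    and "l \<in> X"
    and "rough_I_star_convergent P d I r x l"
  shows "rough_I_convergent P d I r x l"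
  unfolding rough_I_convergent_def
proof (intro allI impI)
  fix \<epsilon>
  assume \<epsilon>: "cone_ll P 0 \<epsilon>"
  have I: "nat_ideal I"
    using assms(3) by (simp add: admissible_ideal_def)
  obtain A and m :: "nat \<Rightarrow> nat" where A: "A \<in> I" and range_m: "range m = UNIV - A"
    and conv: "\<forall>\<epsilon>. cone_ll P 0 \<epsilon> \<longrightarrow> (\<exists>k. \<forall>p\<ge>k. cone_ll P (d (x (m p)) l) (r + \<epsilon>))"
    using assms(7) unfolding rough_I_star_convergent_def ideal_filter_def by blast
  obtain k where k: "\<And>p. k \<le> p \<Longrightarrow> r + \<epsilon> - d (x (m p)) l \<in> interior P"
    using conv \<epsilon> unfolding cone_ll_def by blast
  have "{n. r + \<epsilon> - d (x n) l \<notin> interior P} \<subseteq> A \<union> m ` {..<k}"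
  proof
    fix n
    assume n: "n \<in> {n. r + \<epsilon> - d (x n) l \<notin> interior P}"
    show "n \<in> A \<union> m ` {..<k}"
    proof (cases "n \<in> A")
      case False
      then obtain p where "n = m p"
        using range_m by blast
      moreover from this have "p < k"
        using n k[of p] by (cases "k \<le> p") (simp_all add: not_le)
      ultimately show ?thesis by blast
    qed simp
  qed
  moreover have "A \<union> m ` {..<k} \<in> I"
    by (rule nat_ideal_Un[OF I A finite_in_admissible_ideal[OF assms(3)]]) simp
  ultimately show "{n. r + \<epsilon> - d (x n) l \<notin> interior P} \<in> I"
    using nat_ideal_subset[OF I] by blast
qed

end
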